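(* Fix $\alpha\in(0,1)$, an integer $n\geq 1$, a model class $\mathcal{F}$, and a probability distribution $P$ on $\mathcal{Z}$. For any valid distribution-free lower bound $\hat{L}_\alpha(\mathcal{F},\cdot)$ on the model class risk, it holds that $$\mathbb{P}_P\left\{\hat{L}_\alpha(\mathcal{F},\mathcal{D}_n)>0\right\}\leq\alpha+\frac{n^2}{2N(\mathcal{F},P)}.$$
   Context: Let $\mathcal{Z}$ be the (measurable) data space, $\mathcal{F}$ a set of models (the model class), and $\ell:\mathcal{F}\times\mathcal{Z}\to[0,\infty)$ a loss function. For a probability distribution $P$ on $\mathcal{Z}$ the risk of $f\in\mathcal{F}$ is $R_P(f)=\mathbb{E}_P[\ell(f,Z)]$ with $Z\sim P$, and the model class risk is $R_P(\mathcal{F})=\inf_{f\in\mathcal{F}}R_P(f)$. For a data set $\mathcal{D}_k=(Z_1,\dots,Z_k)\in\mathcal{Z}^k$, the empirical risk is $\hat{R}(f,\mathcal{D}_k)=\frac1k\sum_{i=1}^k\ell(f,Z_i)$ and $\hat{R}(\mathcal{F},\mathcal{D}_k)=\inf_{f\in\mathcal{F}}\hat{R}(f,\mathcal{D}_k)$. $\mathbb{P}_P$ denotes probability when the data are i.i.d. draws from $P$. A map $\hat{L}_\alpha(\mathcal{F},\cdot):\mathcal{Z}^n\to[0,\infty]$ is a valid distribution-free lower bound on the model class risk of $\mathcal{F}$ if $\mathbb{P}_P\{R_P(\mathcal{F})\geq\hat{L}_\alpha(\mathcal{F},\mathcal{D}_n)\}\geq 1-\alpha$ for all distributions $P$ on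 $\mathcal{Z}$, where $\mathcal{D}_n\sim P^n$. The bound may also be randomized: $\hat{L}_\alpha(\mathcal{F},\mathcal{D}_n,\xi)$ may depend on an independent seed $\xi\sim\mathrm{Unif}[0,1]$, in which case all probabilities are also over $\xi$; the seed is suppressed in the notation. The interpolation capacity is $N(\mathcal{F},P)=\sup\{k:\ \hat{R}(\mathcal{F},\mathcal{D}_k)=0\ \text{almost surely when } \mathcal{D}_k\sim P^k\}$, the supremum being over sample sizes $k\geq 1$ (with value $0$ if there is no such $k$, in which case $n^2/(2N(\mathcal F,P))$ is read as $+\infty$; if $N(\mathcal{F},P)=\infty$ it is read as $0$). All functions, infima and events involved are implicitly assumed measurable so that expectations and probabilities are defined. *)

theory Defs
  imports "HOL-Probability.Probability"
begin

text \<open>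
  The data space is a measurable space \<open>M\<close>; the distributions on it are the elements of
  \<open>space (prob_algebra M)\<close>, i.e. the probability measures with the same measurable sets as \<open>M\<close>.
  Risks are valued in \<open>[0,\<infinity>]\<close>, so an infinite expectation is a legitimate value, and the infimum
  over an empty model class is \<open>\<infinity>\<close>. A data set of size \<open>k\<close> is a function on \<open>{..<k}\<close>.
\<close>

definition risk :: "('f \<Rightarrow> 'z \<Rightarrow> real) \<Rightarrow> 'z measure \<Rightarrow> 'f \<Rightarrow> ennreal" where
  "risk l P f = (\<integral>\<^sup>+ z. ennreal (l f z) \<partial>P)"

definition class_risk :: "('f \<Rightarrow> 'z \<Rightarrow> real) \<Rightarrow> 'f set \<Rightarrow> 'z measure \<Rightarrow> ennreal" where
  "class_risk l F P = (INF f\<in>F. risk l P f)"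

definition emp_risk :: "('f \<Rightarrow> 'z \<Rightarrow> real) \<Rightarrow> nat \<Rightarrow> 'f \<Rightarrow> (nat \<Rightarrow> 'z) \<Rightarrow> real" where
  "emp_risk l k f D = (1 / real k) * (\<Sum>i<k. l f (D i))"

definition emp_class_risk :: "('f \<Rightarrow> 'z \<Rightarrow> real) \<Rightarrow> 'f set \<Rightarrow> nat \<Rightarrow> (nat \<Rightarrow> 'z) \<Rightarrow> ennreal" where
  "emp_class_risk l F k D = (INF f\<in>F. ennreal (emp_risk l k f D))"

definition iid :: "nat \<Rightarrow> 'z measure \<Rightarrow> (nat \<Rightarrow> 'z) measure" where
  "iid k P = PiM {..<k} (\<lambda>_. P)"

text \<open>The supremum is taken in \<^typ>\<open>enat\<close>, so it is \<open>0\<close> if no sample size qualifies.\<close>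

definition interp_capacity :: "('f \<Rightarrow> 'z \<Rightarrow> real) \<Rightarrow> 'f set \<Rightarrow> 'z measure \<Rightarrow> enat" where
  "interp_capacity l F P =
     Sup {enat k | k. 1 \<le> k \<and> (AE D in iid k P. emp_class_risk l F k D = 0)}"

text \<open>The joint law of the data and of an independent seed that is uniform on \<open>[0,1]\<close>.\<close>

definition iid_seed :: "nat \<Rightarrow> 'z measure \<Rightarrow> ((nat \<Rightarrow> 'z) \<times> real) measure" where
  "iid_seed n P = iid n P \<Otimes>\<^sub>M uniform_measure lborel {0..1}"

definition valid_lower_bound ::
  "'z measure \<Rightarrow> ('f \<Rightarrow> 'z \<Rightarrow> real) \<Rightarrow> 'f set \<Rightarrow> nat \<Rightarrow> real \<Rightarrow> ((nat \<Rightarrow> 'z) \<Rightarrow> real \<Rightarrow> ennreal) \<Rightarrow> bool"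
where
  "valid_lower_bound M l F n \<alpha> L \<longleftrightarrow>
     (\<lambda>(D, \<xi>). L D \<xi>) \<in> borel_measurable (PiM {..<n} (\<lambda>_. M) \<Otimes>\<^sub>M borel) \<and>
     (\<forall>P\<in>space (prob_algebra M).
        \<P>((D, \<xi>) in iid_seed n P. class_risk l F P \<ge> L D \<xi>) \<ge> 1 - \<alpha>)"

text \<open>
  Bounds without a seed are the case where \<open>L\<close> ignores its second argument: the seed then
  disappears from all probabilities.
\<close>

lemma prob_iid_seed_fst:
  assumes A: "{D \<in> space (iid n P). Q D} \<in> sets (iid n P)"
  shows "\<P>((D, \<xi>) in iid_seed n P. Q D) = \<P>(D in iid n P. Q D)"
proof -
  let ?U = "uniform_measure lborel {0..1::real}"
  have U: "prob_space ?U"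
    by (rule prob_space_uniform_measure) auto
  then interpret U: prob_space ?U .
  have "{(D, \<xi>). (D, \<xi>) \<in> space (iid_seed n P) \<and> Q D} = {D \<in> space (iid n P). Q D} \<times> space ?U"
    by (auto simp: iid_seed_def space_pair_measure)
  moreover have "emeasure (iid_seed n P) ({D \<in> space (iid n P). Q D} \<times> space ?U)
      = emeasure (iid n P) {D \<in> space (iid n P). Q D}"
    unfolding iid_seed_def
    using U.emeasure_pair_measure_Times[OF A sets.top] U.emeasure_space_1 by simp
  ultimately show ?thesis
    unfolding measure_def by (simp only:)
qed

lemma valid_lower_bound_no_seed:
  "valid_lower_bound M l F n \<alpha> (\<lambda>D \<xi>. L D) \<longleftrightarrow>
     L \<in> borel_measurable (PiM {..<n} (\<lambda>_. M)) \<and>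
     (\<forall>P\<in>space (prob_algebra M). \<P>(D in iid n P. class_risk l F P \<ge> L D) \<ge> 1 - \<alpha>)"
  (is "?l \<longleftrightarrow> ?r")
proof -
  let ?N = "PiM {..<n} (\<lambda>_. M)"
  have m: "(\<lambda>(D, \<xi>). L D) \<in> borel_measurable (?N \<Otimes>\<^sub>M (borel :: real measure))
      \<longleftrightarrow> L \<in> borel_measurable ?N"
  proof
    assume *: "(\<lambda>(D, \<xi>). L D) \<in> borel_measurable (?N \<Otimes>\<^sub>M (borel :: real measure))"
    have "(\<lambda>D. (D, 0::real)) \<in> ?N \<rightarrow>\<^sub>M ?N \<Otimes>\<^sub>M borel" by measurable
    from measurable_compose[OF this *] show "L \<in> borel_measurable ?N" by simp
  next
    assume [measurable]: "L \<in> borel_measurable ?N"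
    show "(\<lambda>(D, \<xi>). L D) \<in> borel_measurable (?N \<Otimes>\<^sub>M (borel :: real measure))" by measurable
  qed
  have p: "\<P>((D, \<xi>) in iid_seed n P. class_risk l F P \<ge> L D) = \<P>(D in iid n P. class_risk l F P \<ge> L D)"
    if L: "L \<in> borel_measurable ?N" and P: "P \<in> space (prob_algebra M)" for P
  proof (rule prob_iid_seed_fst)
    have "sets (iid n P) = sets ?N"
      using P by (auto simp: iid_def space_prob_algebra intro!: sets_PiM_cong)
    then have [measurable]: "L \<in> borel_measurable (iid n P)"
      using L by (simp cong: measurable_cong_sets)
    show "{D \<in> space (iid n P). class_risk l F P \<ge> L D} \<in> sets (iid n P)" by measurable
  qed
  show ?thesis
    unfolding valid_lower_bound_def using m p by auto
qed

end

theory Submission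
  imports Defs "HOL-Real_Asymp.Real_Asymp"
begin

text \<open>
  A data set on which the class interpolates looks, to the bound, like a distribution on which the
  class has risk zero. Let \<open>k\<close> be a sample size at which the empirical class risk vanishes
  almost surely, and draw \<open>D\<close> from \<open>P\<^sup>k\<close>. The empirical measure of \<open>D\<close> is itself a
  distribution on the data space, and its class risk is the empirical class risk of \<open>D\<close>, that is
  \<open>0\<close> (\<open>class_risk_emp_measure\<close>). A distribution-free bound must be valid at this distribution as
  well, so on \<open>n\<close> points drawn from it the bound is positive with probability at most \<open>\<alpha>\<close>
  (\<open>positive_prob_le_of_zero_class_risk\<close>).

  Drawing from the empirical measure means choosing \<open>n\<close> indices below \<open>k\<close> uniformly and with
  replacement (\<open>iid_emp_measure\<close>). If the indices are distinct, then the chosen points are, after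
  averaging over \<open>D\<close>, an honest sample from \<open>P\<^sup>n\<close> (\<open>nn_integral_resample_injective\<close>). Hence,
  with \<open>p\<close> the probability under \<open>P\<close> that the bound is positive, the probability that the indices
  are distinct, times \<open>p\<close>, is at most \<open>\<alpha>\<close>. By the birthday bound the indices collide with
  probability at most \<open>n\<^sup>2 / (2 k)\<close> (\<open>card_non_injective_le\<close>), which gives
  \<open>p \<le> \<alpha> + n\<^sup>2 / (2 k)\<close>. It remains to let \<open>k\<close> increase to the interpolation capacity.
\<close>

section \<open>Collisions among indices drawn with replacement\<close>

text \<open>
  The birthday bound, cleared of denominators. An index map on \<open>Suc n\<close> points with a collision
  either has one among the first \<open>n\<close> points, and then its last value is free, or its last value
  repeats one of \<open>n\<close> earlier ones. The count \<open>b\<^sub>n\<close> of such maps thus satisfies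
  \<open>b\<^bsub>n+1\<^esub> \<le> k b\<^sub>n + n k\<^sup>n\<close>.
\<close>
lemma card_non_injective_le:
  fixes n k :: nat
  shows "2 * k * card {I \<in> {..<n} \<rightarrow>\<^sub>E {..<k}. \<not> inj_on I {..<n}} \<le> n\<^sup>2 * k ^ n"
proof (induction n)
  case 0
  then show ?case by simp
next
  case (Suc n)
  let ?S = "\<lambda>n. {..<n} \<rightarrow>\<^sub>E {..<k}"
  let ?B = "\<lambda>n. {I \<in> ?S n. \<not> inj_on I {..<n}}"
  have fin: "finite (?S m)" for m :: nat by (intro finite_PiE) auto
  have "?B (Suc n) \<subseteq> (\<lambda>(y, g). g(n := y)) ` ({..<k} \<times> ?B n)
      \<union> (\<lambda>(i, g). g(n := g i)) ` ({..<n} \<times> ?S n)"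
  (* The extension value y is a free choice, or the value at an earlier index i. *)
  proof
    fix I assume I: "I \<in> ?B (Suc n)"
    then obtain y g where g: "I = g(n := y)" "y < k" "g \<in> ?S n"
      by (auto simp: lessThan_Suc PiE_insert_eq)
    have restr: "inj_on I {..<n} \<longleftrightarrow> inj_on g {..<n}"
      unfolding g(1) by (intro inj_on_cong) auto
    show "I \<in> (\<lambda>(y, g). g(n := y)) ` ({..<k} \<times> ?B n)
      \<union> (\<lambda>(i, g). g(n := g i)) ` ({..<n} \<times> ?S n)"
    proof (cases "inj_on g {..<n}")
      case False
      then have "(y, g) \<in> {..<k} \<times> ?B n" using g by auto
      then show ?thesis using g(1) by (intro UnI1 image_eqI[where x = "(y, g)"]) auto
    next
      case True
      then have "I n \<in> I ` {..<n}"
        using I restr by (auto simp: lessThan_Suc)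
      then obtain i where "i < n" "y = g i" using g(1) by auto
      then show ?thesis using g by (intro UnI2 image_eqI[where x = "(i, g)"]) auto
    qed
  qed
  then have "card (?B (Suc n)) \<le> card ((\<lambda>(y, g). g(n := y)) ` ({..<k} \<times> ?B n)
      \<union> (\<lambda>(i, g). g(n := g i)) ` ({..<n} \<times> ?S n))"
    using fin by (intro card_mono) auto
  also have "\<dots> \<le> card ((\<lambda>(y, g). g(n := y)) ` ({..<k} \<times> ?B n))
      + card ((\<lambda>(i, g). g(n := g i)) ` ({..<n} \<times> ?S n))"
    by (rule card_Un_le)
  also have "\<dots> \<le> card ({..<k} \<times> ?B n) + card ({..<n} \<times> ?S n)"
    using fin by (intro add_mono card_image_le) auto
  also have "\<dots> = k * card (?B n) + n * k ^ n"
    by (simp add: card_PiE card_cartesian_product)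
  finally have "2 * k * card (?B (Suc n)) \<le> k * (2 * k * card (?B n)) + 2 * n * k ^ Suc n"
    using mult_le_mono2[of "card (?B (Suc n))" "k * card (?B n) + n * k ^ n" "2 * k"]
    by (simp add: algebra_simps)
  also have "\<dots> \<le> k * (n\<^sup>2 * k ^ n) + 2 * n * k ^ Suc n"
    using mult_le_mono2[OF Suc.IH, of k] by simp
  also have "\<dots> \<le> (Suc n)\<^sup>2 * k ^ Suc n"
    by (simp add: algebra_simps power2_eq_square)
  finally show ?case .
qed

section \<open>Sampling from a data set with replacement\<close>

definition resample :: "nat \<Rightarrow> (nat \<Rightarrow> 'z) \<Rightarrow> (nat \<Rightarrow> nat) \<Rightarrow> nat \<Rightarrow> 'z" where
  "resample n D I = (\<lambda>j\<in>{..<n}. D (I j))"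

text \<open>
  The index set carries the uniform law as a measure of its own, rather than as a probability mass
  function on all of \<open>nat\<close>: a data set may leave the data space at indices \<open>\<ge> k\<close>, and so
  only its restriction to \<open>{..<k}\<close> is a random point of that space.
\<close>
definition emp_measure :: "'z measure \<Rightarrow> nat \<Rightarrow> (nat \<Rightarrow> 'z) \<Rightarrow> 'z measure" where
  "emp_measure M k D = distr (uniform_count_measure {..<k}) M D"

lemma resample_measurable:
  assumes "I \<in> {..<n} \<rightarrow>\<^sub>E {..<k}"
  shows "(\<lambda>D. resample n D I) \<in> PiM {..<k} (\<lambda>_. M) \<rightarrow>\<^sub>M PiM {..<n} (\<lambda>_. M)"
  unfolding resample_def using assms
  by (intro measurable_restrict measurable_component_singleton) (auto simp: PiE_iff)

text \<open>
  Distinct coordinates of an i.i.d. sample are again an i.i.d. sample; repeated coordinates are not,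
  which is why collisions have to be paid for.
\<close>
lemma nn_integral_resample_injective:
  assumes "prob_space P" "I \<in> {..<n} \<rightarrow>\<^sub>E {..<k}" "inj_on I {..<n}"
    and h: "h \<in> borel_measurable (PiM {..<n} (\<lambda>_. P))"
  shows "(\<integral>\<^sup>+D. h (resample n D I) \<partial>iid k P) = (\<integral>\<^sup>+D. h D \<partial>iid n P)"
proof -
  have "distr (iid k P) (iid n P) (\<lambda>D. resample n D I) = iid n P"
    unfolding iid_def resample_def
    using assms by (intro distr_PiM_reindex) (auto simp: PiE_iff)
  then have "(\<integral>\<^sup>+D. h D \<partial>iid n P) = (\<integral>\<^sup>+D. h D \<partial>distr (iid k P) (iid n P) (\<lambda>D. resample n D I))"
    by simp
  also have "\<dots> = (\<integral>\<^sup>+D. h (resample n D I) \<partial>iid k P)"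
    using resample_measurable[OF assms(2), of P] h
    by (intro nn_integral_distr) (simp_all add: iid_def)
  finally show ?thesis ..
qed

lemma nn_integral_uniform_count:
  assumes "finite A"
  shows "(\<integral>\<^sup>+x. f x \<partial>uniform_count_measure A) = (\<Sum>x\<in>A. f x) / of_nat (card A)"
proof (cases "A = {}")
  case True
  then show ?thesis
    using assms by (simp add: uniform_count_measure_def nn_integral_point_measure_finite)
next
  case False
  then have "ennreal (1 / card A) = inverse (of_nat (card A))"
    using assms by (simp add: inverse_ennreal ennreal_of_nat_eq_real_of_nat card_gt_0_iff inverse_eq_divide)
  then show ?thesis
    using assms unfolding uniform_count_measure_def
    by (simp add: nn_integral_point_measure_finite divide_ennreal_def sum_distrib_right mult.commute)
qed

context
  fixes M :: "'z measure" and k :: nat and D :: "nat \<Rightarrow> 'z"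
  assumes k: "1 \<le> k" and D: "D \<in> space (PiM {..<k} (\<lambda>_. M))"
begin

lemma data_measurable: "D \<in> uniform_count_measure {..<k} \<rightarrow>\<^sub>M M"
  using D by (auto simp: measurable_def space_uniform_count_measure sets_uniform_count_measure
      space_PiM PiE_iff)

lemma emp_measure_in_prob_algebra: "emp_measure M k D \<in> space (prob_algebra M)"
proof -
  have "{..<k} \<noteq> {}" using k by (auto simp: lessThan_empty_iff)
  then show ?thesis
    unfolding space_prob_algebra emp_measure_def
    by (auto intro!: prob_space.prob_space_distr prob_space_uniform_count_measure data_measurable)
qed

lemma risk_emp_measure:
  assumes "\<And>z. z \<in> space M \<Longrightarrow> 0 \<le> l f z" "l f \<in> borel_measurable M"
  shows "risk l (emp_measure M k D) f = ennreal (emp_risk l k f D)"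
proof -
  have nonneg: "0 \<le> l f (D i)" if "i < k" for i
    using D that by (intro assms(1)) (auto simp: space_PiM PiE_iff)
  have "risk l (emp_measure M k D) f = (\<integral>\<^sup>+i. ennreal (l f (D i)) \<partial>uniform_count_measure {..<k})"
    unfolding risk_def emp_measure_def
    using assms(2) data_measurable by (intro nn_integral_distr) auto
  also have "\<dots> = (\<Sum>i<k. ennreal (l f (D i))) / of_nat k"
    by (simp add: nn_integral_uniform_count)
  also have "\<dots> = ennreal (emp_risk l k f D)"
  proof -
    have "(\<Sum>i<k. ennreal (l f (D i))) = ennreal (\<Sum>i<k. l f (D i))"
      using nonneg by (intro sum_ennreal) auto
    moreover have "0 \<le> (\<Sum>i<k. l f (D i))"
      using nonneg by (intro sum_nonneg) auto
    ultimately show ?thesis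
      using k by (simp add: emp_risk_def divide_ennreal ennreal_of_nat_eq_real_of_nat)
  qed
  finally show ?thesis .
qed

text \<open>
  This identity makes interpolation relevant: validity, which speaks of class risks of
  distributions, can be applied to data sets.
\<close>
lemma class_risk_emp_measure:
  assumes "\<And>f z. f \<in> F \<Longrightarrow> z \<in> space M \<Longrightarrow> 0 \<le> l f z"
    and "\<And>f. f \<in> F \<Longrightarrow> l f \<in> borel_measurable M"
  shows "class_risk l F (emp_measure M k D) = emp_class_risk l F k D"
  unfolding class_risk_def emp_class_risk_def
  using assms by (intro INF_cong) (auto intro!: risk_emp_measure)

lemma resample_indices_measurable:
  "resample n D \<in> uniform_count_measure ({..<n} \<rightarrow>\<^sub>E {..<k}) \<rightarrow>\<^sub>M PiM {..<n} (\<lambda>_. M)"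
  using D by (auto simp: measurable_def space_uniform_count_measure sets_uniform_count_measure
      resample_def space_PiM PiE_iff)

text \<open>
  Both sides agree on boxes \<open>\<Pi> A\<^sub>j\<close>: the index maps that send each \<open>j\<close> to a data point in \<open>A\<^sub>j\<close> form a box
  themselves, so their number is the product of the numbers of data points in the \<open>A\<^sub>j\<close>.
\<close>
lemma iid_emp_measure:
  "iid n (emp_measure M k D)
     = distr (uniform_count_measure ({..<n} \<rightarrow>\<^sub>E {..<k})) (PiM {..<n} (\<lambda>_. M)) (resample n D)"
  (is "_ = ?R")
proof -
  let ?S = "{..<n} \<rightarrow>\<^sub>E {..<k}"
  let ?E = "emp_measure M k D"
  have E: "prob_space ?E" "sets ?E = sets M"
    using emp_measure_in_prob_algebra by (auto simp: space_prob_algebra)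
  interpret E: prob_space ?E by fact
  interpret product_sigma_finite "\<lambda>_::nat. ?E" by standard
  have finS: "finite ?S"
    by (intro finite_PiE) auto
  note meas = resample_indices_measurable[of n]
  have "?R = PiM {..<n} (\<lambda>_. ?E)"
  proof (rule PiM_eqI)
    show "sets ?R = sets (PiM {..<n} (\<lambda>_. ?E))"
      using E by (auto intro!: sets_PiM_cong)
  next
    fix A assume A: "\<And>i. i \<in> {..<n} \<Longrightarrow> A i \<in> sets ?E"
    let ?C = "\<lambda>j. {i \<in> {..<k}. D i \<in> A j}"
    have "emeasure ?R (PiE {..<n} A) = emeasure (uniform_count_measure ?S)
        (resample n D -` PiE {..<n} A \<inter> ?S)"
      using A E(2) meas by (subst emeasure_distr) (auto simp: space_uniform_count_measure)
    also have "resample n D -` PiE {..<n} A \<inter> ?S = PiE {..<n} ?C"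
    proof (rule set_eqI)
      fix I
      show "I \<in> resample n D -` PiE {..<n} A \<inter> ?S \<longleftrightarrow> I \<in> PiE {..<n} ?C"
        unfolding resample_def vimage_eq Int_iff restrict_PiE_iff by (auto simp: PiE_iff)
    qed
    also have "emeasure (uniform_count_measure ?S) (PiE {..<n} ?C)
        = ennreal ((\<Prod>j<n. card (?C j)) / k ^ n)"
    proof -
      have "PiE {..<n} ?C \<subseteq> ?S" by (intro PiE_mono) auto
      with finS show ?thesis by (simp add: emeasure_uniform_count_measure card_PiE)
    qed
    also have "\<dots> = (\<Prod>j<n. ennreal (card (?C j) / k))"
      by (subst prod_ennreal) (auto simp: prod_dividef)
    also have "\<dots> = (\<Prod>j<n. emeasure ?E (A j))"
    proof (rule prod.cong)
      fix j assume "j \<in> {..<n}"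
      then have "A j \<in> sets M" using A E(2) by auto
      then have "emeasure ?E (A j) = emeasure (uniform_count_measure {..<k}) (D -` A j \<inter> {..<k})"
        unfolding emp_measure_def using data_measurable
        by (subst emeasure_distr) (auto simp: space_uniform_count_measure)
      also have "D -` A j \<inter> {..<k} = ?C j" by auto
      finally show "ennreal (card (?C j) / k) = emeasure ?E (A j)"
        by (subst (asm) emeasure_uniform_count_measure) auto
    qed simp
    finally show "emeasure ?R (PiE {..<n} A) = (\<Prod>j<n. emeasure ?E (A j))" .
  qed auto
  then show ?thesis by (simp add: iid_def)
qed

lemma nn_integral_iid_emp_measure:
  assumes "h \<in> borel_measurable (PiM {..<n} (\<lambda>_. M))"
  shows "(\<integral>\<^sup>+x. h x \<partial>iid n (emp_measure M k D))
     = (\<Sum>I\<in>{..<n} \<rightarrow>\<^sub>E {..<k}. h (resample n D I)) / of_nat (k ^ n)"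
proof -
  show ?thesis
    unfolding iid_emp_measure using assms resample_indices_measurable
    by (simp add: nn_integral_distr nn_integral_uniform_count finite_PiE card_PiE)
qed

end


text \<open>
  The right-hand side averages \<open>h\<close> over a random data set and all \<open>k\<^sup>n\<close> index maps; dropping the maps
  with a collision only decreases the sum, and each remaining one contributes the integral of \<open>h\<close>
  under \<open>P\<^sup>n\<close>.
\<close>
lemma injective_resampling_le_average:
  assumes P: "P \<in> space (prob_algebra M)" and k: "1 \<le> k"
    and h: "h \<in> borel_measurable (PiM {..<n} (\<lambda>_. M))"
  shows "of_nat (card {I \<in> {..<n} \<rightarrow>\<^sub>E {..<k}. inj_on I {..<n}}) * (\<integral>\<^sup>+D. h D \<partial>iid n P)
    \<le> of_nat (k ^ n) * (\<integral>\<^sup>+D. (\<integral>\<^sup>+D'. h D' \<partial>iid n (emp_measure M k D)) \<partial>iid k P)"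
proof -
  let ?S = "{..<n} \<rightarrow>\<^sub>E {..<k}"
  let ?J = "{I \<in> ?S. inj_on I {..<n}}"
  have prob: "prob_space P" and sets: "sets P = sets M"
    using P by (auto simp: space_prob_algebra)
  have sets_iid: "sets (iid m P) = sets (PiM {..<m} (\<lambda>_. M))" for m
    unfolding iid_def using sets by (intro sets_PiM_cong) auto
  have h': "h \<in> borel_measurable (PiM {..<n} (\<lambda>_. P))"
    using h sets_iid[of n] by (simp add: iid_def cong: measurable_cong_sets)
  have fin: "finite ?S" by (intro finite_PiE) auto
  have meas: "(\<lambda>D. h (resample n D I)) \<in> borel_measurable (iid k P)" if "I \<in> ?S" for I
    using measurable_compose[OF resample_measurable[OF that] h] sets_iid[of k]
    by (simp cong: measurable_cong_sets)
  have "of_nat (card ?J) * (\<integral>\<^sup>+D. h D \<partial>iid n P)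
      = (\<Sum>I\<in>?J. \<integral>\<^sup>+D. h (resample n D I) \<partial>iid k P)"
    using nn_integral_resample_injective[OF prob _ _ h'] by simp
  also have "\<dots> \<le> (\<Sum>I\<in>?S. \<integral>\<^sup>+D. h (resample n D I) \<partial>iid k P)"
    using fin by (intro sum_mono2) auto
  also have "\<dots> = (\<integral>\<^sup>+D. (\<Sum>I\<in>?S. h (resample n D I)) \<partial>iid k P)"
    using meas by (intro nn_integral_sum[symmetric])
  also have "\<dots> = (\<integral>\<^sup>+D. of_nat (k ^ n) * (\<integral>\<^sup>+D'. h D' \<partial>iid n (emp_measure M k D)) \<partial>iid k P)"
  proof (rule nn_integral_cong)
    fix D assume "D \<in> space (iid k P)"
    then have D: "D \<in> space (PiM {..<k} (\<lambda>_. M))"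
      using sets_eq_imp_space_eq[OF sets_iid] by simp
    have "(of_nat (k ^ n) :: ennreal) \<noteq> 0" "(of_nat (k ^ n) :: ennreal) \<noteq> top"
      using k by (auto simp: ennreal_of_nat_neq_top simp del: of_nat_power)
    then have "of_nat (k ^ n) * (x / of_nat (k ^ n)) = x" for x :: ennreal
      by (metis ennreal_mult_divide_eq ennreal_times_divide mult.commute)
    then show "(\<Sum>I\<in>?S. h (resample n D I))
        = of_nat (k ^ n) * (\<integral>\<^sup>+D'. h D' \<partial>iid n (emp_measure M k D))"
      unfolding nn_integral_iid_emp_measure[OF k D h]
      by simp
  qed
  also have "\<dots> = of_nat (k ^ n) * (\<integral>\<^sup>+D. (\<integral>\<^sup>+D'. h D' \<partial>iid n (emp_measure M k D)) \<partial>iid k P)"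
  proof (rule nn_integral_cmult)
    have "(\<lambda>D. (\<Sum>I\<in>?S. h (resample n D I)) / of_nat (k ^ n)) \<in> borel_measurable (iid k P)"
      using meas by (intro borel_measurable_divide_ennreal borel_measurable_sum) auto
    then show "(\<lambda>D. \<integral>\<^sup>+D'. h D' \<partial>iid n (emp_measure M k D)) \<in> borel_measurable (iid k P)"
    proof (rule subst[OF measurable_cong, rotated])
      fix D assume "D \<in> space (iid k P)"
      then have D: "D \<in> space (PiM {..<k} (\<lambda>_. M))"
        using sets_eq_imp_space_eq[OF sets_iid] by simp
      show "(\<Sum>I\<in>?S. h (resample n D I)) / of_nat (k ^ n)
          = (\<integral>\<^sup>+D'. h D' \<partial>iid n (emp_measure M k D))"
        by (rule nn_integral_iid_emp_measure[OF k D h, symmetric])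
    qed
  qed
  finally show ?thesis .
qed

text \<open>
  The loss from the maps with a collision is at most their proportion because \<open>p \<le> 1\<close>.
\<close>
lemma le_add_of_injective_average:
  fixes p \<alpha> :: real and n k :: nat
  assumes "1 \<le> k" "0 \<le> p" "p \<le> 1"
    and avg: "card {I \<in> {..<n} \<rightarrow>\<^sub>E {..<k}. inj_on I {..<n}} * p \<le> k ^ n * \<alpha>"
  shows "p \<le> \<alpha> + (real n)\<^sup>2 / (2 * real k)"
proof -
  let ?S = "{..<n} \<rightarrow>\<^sub>E {..<k}"
  let ?J = "{I \<in> ?S. inj_on I {..<n}}" and ?B = "{I \<in> ?S. \<not> inj_on I {..<n}}"
  have fin: "finite ?S" by (intro finite_PiE) auto
  have "card ?S = card ?J + card ?B"
    using fin by (subst card_Un_disjoint[symmetric]) (auto intro!: arg_cong[where f = card])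
  then have split: "real (k ^ n) = card ?J + card ?B"
    by (simp add: card_PiE)
  have "real (2 * k * card ?B) \<le> real (n\<^sup>2 * k ^ n)"
    using card_non_injective_le[where n = n and k = k] by (intro of_nat_mono)
  then have bad: "real (card ?B) \<le> k ^ n * ((real n)\<^sup>2 / (2 * real k))"
    using assms(1) by (simp add: field_simps)
  have "real (k ^ n) * p = card ?J * p + card ?B * p"
    unfolding split by (simp add: algebra_simps)
  also have "\<dots> \<le> k ^ n * \<alpha> + card ?B"
    using avg assms(2,3) mult_left_le[of p "card ?B"] by simp
  also have "\<dots> \<le> real (k ^ n) * (\<alpha> + (real n)\<^sup>2 / (2 * real k))"
    using bad by (simp add: distrib_left)
  finally show ?thesis
    using assms(1) by (simp del: of_nat_power)
qed

section \<open>The probability that a valid bound is positive\<close>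

abbreviation seed :: "real measure" where
  "seed \<equiv> uniform_measure lborel {0..1}"

lemma prob_space_seed: "prob_space seed"
  by (rule prob_space_uniform_measure) auto

text \<open>
  Integrating out the seed first turns the randomized bound into the function of the data
  \<open>D \<mapsto> emeasure seed (Pair D -` A)\<close>, to which the resampling inequality applies. The measurable sets
  refer to \<open>M\<close> and not to \<open>Q\<close>, so that one such function serves the empirical measures of all data sets.
\<close>
lemma emeasure_iid_seed:
  assumes "sets Q = sets M"
    and A: "A \<in> sets (PiM {..<n} (\<lambda>_. M) \<Otimes>\<^sub>M borel)"
  shows "A \<in> sets (iid_seed n Q)"
    and "emeasure (iid_seed n Q) A = (\<integral>\<^sup>+D. emeasure seed (Pair D -` A) \<partial>iid n Q)"
    and "(\<lambda>D. emeasure seed (Pair D -` A)) \<in> borel_measurable (PiM {..<n} (\<lambda>_. M))"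
proof -
  interpret seed: prob_space seed by (rule prob_space_seed)
  have "sets (iid n Q) = sets (PiM {..<n} (\<lambda>_. M))"
    unfolding iid_def using assms(1) by (intro sets_PiM_cong) auto
  then have "sets (iid n Q \<Otimes>\<^sub>M seed) = sets (PiM {..<n} (\<lambda>_. M) \<Otimes>\<^sub>M borel)"
    by (intro sets_pair_measure_cong) auto
  with A have A': "A \<in> sets (iid n Q \<Otimes>\<^sub>M seed)" by simp
  then show "A \<in> sets (iid_seed n Q)" by (simp add: iid_seed_def)
  show "emeasure (iid_seed n Q) A = (\<integral>\<^sup>+D. emeasure seed (Pair D -` A) \<partial>iid n Q)"
    unfolding iid_seed_def by (rule seed.emeasure_pair_measure_alt[OF A'])
  have "A \<in> sets (PiM {..<n} (\<lambda>_. M) \<Otimes>\<^sub>M seed)"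
    using A by (simp cong: sets_pair_measure_cong)
  then show "(\<lambda>D. emeasure seed (Pair D -` A)) \<in> borel_measurable (PiM {..<n} (\<lambda>_. M))"
    by (rule seed.measurable_emeasure_Pair)
qed

lemma prob_space_iid_seed:
  assumes "prob_space Q"
  shows "prob_space (iid_seed n Q)"
proof -
  interpret D: prob_space "iid n Q"
    unfolding iid_def using assms by (intro prob_space_PiM)
  interpret seed: prob_space seed by (rule prob_space_seed)
  interpret pair_prob_space "iid n Q" seed ..
  show ?thesis
    unfolding iid_seed_def by (rule P.prob_space_axioms)
qed

definition positive_set :: "'z measure \<Rightarrow> nat \<Rightarrow> ((nat \<Rightarrow> 'z) \<Rightarrow> real \<Rightarrow> ennreal) \<Rightarrow> ((nat \<Rightarrow> 'z) \<times> real) set" where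
  "positive_set M n L = {x \<in> space (PiM {..<n} (\<lambda>_. M) \<Otimes>\<^sub>M borel). 0 < case_prod L x}"

lemma positive_set_iid_seed:
  assumes "sets Q = sets M"
  shows "{(D, \<xi>). (D, \<xi>) \<in> space (iid_seed n Q) \<and> L D \<xi> > 0} = positive_set M n L"
proof -
  have "space (iid n Q) = space (PiM {..<n} (\<lambda>_. M))"
    unfolding iid_def using assms by (intro sets_eq_imp_space_eq sets_PiM_cong) auto
  then show ?thesis
    by (auto simp: positive_set_def iid_seed_def space_pair_measure)
qed

lemma positive_prob_le_of_zero_class_risk:
  assumes valid: "valid_lower_bound M l F n \<alpha> L"
    and Q: "Q \<in> space (prob_algebra M)" and zero: "class_risk l F Q = 0"
  shows "emeasure (iid_seed n Q) (positive_set M n L) \<le> ennreal \<alpha>"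
proof -
  have prob: "prob_space Q" and sets: "sets Q = sets M"
    using Q by (auto simp: space_prob_algebra)
  have [measurable]: "case_prod L \<in> borel_measurable (PiM {..<n} (\<lambda>_. M) \<Otimes>\<^sub>M borel)"
    using valid by (simp add: valid_lower_bound_def)
  interpret prob_space "iid_seed n Q" by (rule prob_space_iid_seed[OF prob])
  have "positive_set M n L \<in> sets (PiM {..<n} (\<lambda>_. M) \<Otimes>\<^sub>M borel)"
    unfolding positive_set_def by measurable
  note A = emeasure_iid_seed(1)[OF sets this]
  have "{(D, \<xi>). (D, \<xi>) \<in> space (iid_seed n Q) \<and> class_risk l F Q \<ge> L D \<xi>}
      = space (iid_seed n Q) - positive_set M n L"
    unfolding positive_set_iid_seed[OF sets, symmetric] zero by (auto simp: zero_less_iff_neq_zero)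
  moreover have "1 - \<alpha> \<le> \<P>((D, \<xi>) in iid_seed n Q. class_risk l F Q \<ge> L D \<xi>)"
    using valid Q by (auto simp: valid_lower_bound_def)
  ultimately have "1 - \<alpha> \<le> prob (space (iid_seed n Q) - positive_set M n L)"
    by simp
  then have "prob (positive_set M n L) \<le> \<alpha>"
    using prob_compl[OF A] by simp
  then show ?thesis
    by (simp add: emeasure_eq_measure ennreal_leI)
qed

text \<open>
  The sample size \<open>k\<close> of the interpolated data is unrelated to \<open>n\<close>. When \<open>k < n\<close> every index map has a
  collision, and the inequality holds because its right-hand side exceeds \<open>1\<close>.
\<close>
lemma positive_prob_le_of_interpolation:
  assumes \<alpha>: "0 \<le> \<alpha>"
    and nonneg: "\<And>f z. f \<in> F \<Longrightarrow> z \<in> space M \<Longrightarrow> 0 \<le> l f z"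
    and meas: "\<And>f. f \<in> F \<Longrightarrow> l f \<in> borel_measurable M"
    and P: "P \<in> space (prob_algebra M)"
    and valid: "valid_lower_bound M l F n \<alpha> L"
    and k: "1 \<le> k" and interp: "AE D in iid k P. emp_class_risk l F k D = 0"
  shows "\<P>((D, \<xi>) in iid_seed n P. L D \<xi> > 0) \<le> \<alpha> + (real n)\<^sup>2 / (2 * real k)"
proof -
  let ?A = "positive_set M n L"
  let ?h = "\<lambda>D. emeasure seed (Pair D -` ?A)"
  let ?J = "{I \<in> {..<n} \<rightarrow>\<^sub>E {..<k}. inj_on I {..<n}}"
  have prob: "prob_space P" and sets: "sets P = sets M"
    using P by (auto simp: space_prob_algebra)
  have [measurable]: "case_prod L \<in> borel_measurable (PiM {..<n} (\<lambda>_. M) \<Otimes>\<^sub>M borel)"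
    using valid by (simp add: valid_lower_bound_def)
  have A: "?A \<in> sets (PiM {..<n} (\<lambda>_. M) \<Otimes>\<^sub>M borel)"
    unfolding positive_set_def by measurable
  interpret Dk: prob_space "iid k P"
    unfolding iid_def using prob by (intro prob_space_PiM)
  interpret prob_space "iid_seed n P" by (rule prob_space_iid_seed[OF prob])
  have bound: "AE D in iid k P. (\<integral>\<^sup>+D'. ?h D' \<partial>iid n (emp_measure M k D)) \<le> ennreal \<alpha>"
    using interp
  proof (rule AE_mp, intro AE_I2 impI)
    fix D assume D: "D \<in> space (iid k P)" and zero: "emp_class_risk l F k D = 0"
    have "space (iid k P) = space (PiM {..<k} (\<lambda>_. M))"
      unfolding iid_def using sets by (intro sets_eq_imp_space_eq sets_PiM_cong) auto
    with D have D: "D \<in> space (PiM {..<k} (\<lambda>_. M))" by simp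
    note emp = emp_measure_in_prob_algebra[OF k D]
    have "class_risk l F (emp_measure M k D) = 0"
      using class_risk_emp_measure[OF k D, of F l] nonneg meas zero by simp
    then have "emeasure (iid_seed n (emp_measure M k D)) ?A \<le> ennreal \<alpha>"
      by (rule positive_prob_le_of_zero_class_risk[OF valid emp])
    then show "(\<integral>\<^sup>+D'. ?h D' \<partial>iid n (emp_measure M k D)) \<le> ennreal \<alpha>"
      using emp by (subst emeasure_iid_seed(2)[OF _ A, symmetric]) (auto simp: space_prob_algebra)
  qed
  have "of_nat (card ?J) * emeasure (iid_seed n P) ?A
      \<le> of_nat (k ^ n) * (\<integral>\<^sup>+D. (\<integral>\<^sup>+D'. ?h D' \<partial>iid n (emp_measure M k D)) \<partial>iid k P)"
    unfolding emeasure_iid_seed(2)[OF sets A]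
    by (rule injective_resampling_le_average[OF P k emeasure_iid_seed(3)[OF sets A]])
  also have "\<dots> \<le> of_nat (k ^ n) * (\<integral>\<^sup>+D. ennreal \<alpha> \<partial>iid k P)"
    using bound by (intro mult_left_mono nn_integral_mono_AE) auto
  also have "\<dots> = ennreal (k ^ n * \<alpha>)"
    using \<alpha> by (simp add: Dk.emeasure_space_1 ennreal_mult ennreal_of_nat_eq_real_of_nat del: of_nat_power)
  finally have "ennreal (card ?J * prob ?A) \<le> ennreal (k ^ n * \<alpha>)"
    by (simp add: emeasure_eq_measure ennreal_mult ennreal_of_nat_eq_real_of_nat)
  then have "card ?J * prob ?A \<le> k ^ n * \<alpha>"
    using \<alpha> by (subst (asm) ennreal_le_iff) auto
  then have "prob ?A \<le> \<alpha> + (real n)\<^sup>2 / (2 * real k)"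
    using k by (intro le_add_of_injective_average) auto
  then show ?thesis
    by (simp only: positive_set_iid_seed[OF sets])
qed

text \<open>
  Approximating the supremum from below by interpolating sample sizes covers finite and infinite
  capacities alike. Overshooting \<open>m\<close> is harmless because \<open>n\<^sup>2 / (2 k)\<close> decreases in \<open>k\<close>.
\<close>
lemma exists_interpolating_size:
  assumes "1 \<le> m" "enat m \<le> interp_capacity l F P"
  obtains k where "m \<le> k" "AE D in iid k P. emp_class_risk l F k D = 0"
proof -
  have "enat (m - 1) < interp_capacity l F P"
    using assms by (metis Suc_pred' enat_ord_simps(2) le_less_trans lessI less_le_trans less_le
        not_one_le_zero One_nat_def Suc_le_eq)
  then obtain k where "enat (m - 1) < enat k" "AE D in iid k P. emp_class_risk l F k D = 0"
    unfolding interp_capacity_def less_Sup_iff by auto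
  then show thesis
    using assms(1) by (intro that[of k]) auto
qed

theorem corollary5:
  fixes M P :: "'z measure"
    and F :: "'f set"
    and l :: "'f \<Rightarrow> 'z \<Rightarrow> real"
    and n :: nat
    and \<alpha> :: real
    and L :: "(nat \<Rightarrow> 'z) \<Rightarrow> real \<Rightarrow> ennreal"
  assumes "0 < \<alpha>" and "\<alpha> < 1"
    and "n \<ge> 1"
    and "\<And>f z. f \<in> F \<Longrightarrow> z \<in> space M \<Longrightarrow> 0 \<le> l f z"
    and "\<And>f. f \<in> F \<Longrightarrow> l f \<in> borel_measurable M"
    and "P \<in> space (prob_algebra M)"
    and "valid_lower_bound M l F n \<alpha> L"
  shows "ennreal (\<P>((D, \<xi>) in iid_seed n P. L D \<xi> > 0))
           \<le> ennreal \<alpha> + (of_nat n)\<^sup>2 / (2 * ennreal_of_enat (interp_capacity l F P))"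
proof -
  let ?p = "\<P>((D, \<xi>) in iid_seed n P. L D \<xi> > 0)"
  have bound: "?p \<le> \<alpha> + (real n)\<^sup>2 / (2 * real m)" if m: "1 \<le> m" "enat m \<le> interp_capacity l F P" for m
  proof -
    obtain k where k: "m \<le> k" "AE D in iid k P. emp_class_risk l F k D = 0"
      using exists_interpolating_size[OF m] .
    have "?p \<le> \<alpha> + (real n)\<^sup>2 / (2 * real k)"
      using assms(1) k m(1)
      by (intro positive_prob_le_of_interpolation[OF _ assms(4-7)]) auto
    also have "\<dots> \<le> \<alpha> + (real n)\<^sup>2 / (2 * real m)"
      using k(1) m(1) by (intro add_left_mono divide_left_mono) auto
    finally show ?thesis .
  qed
  show ?thesis
  proof (cases "interp_capacity l F P")
    case (enat m)
    show ?thesis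
    proof (cases "m = 0")
      case True
      (* Since n is positive, the quotient by 0 is infinite and the inequality is trivial. *)
      then show ?thesis
        using enat assms(3) by (simp add: zero_enat_def[symmetric] ennreal_divide_zero)
    next
      case False
      have "ennreal ?p \<le> ennreal (\<alpha> + (real n)\<^sup>2 / (2 * real m))"
        using bound[of m] False enat by (intro ennreal_leI) auto
      also have "\<dots> = ennreal \<alpha> + ennreal ((real n)\<^sup>2 / (2 * real m))"
        using assms(1) by (intro ennreal_plus) auto
      also have "ennreal ((real n)\<^sup>2 / (2 * real m)) = ennreal ((real n)\<^sup>2) / ennreal (2 * real m)"
        using False by (intro divide_ennreal[symmetric]) auto
      also have "\<dots> = (of_nat n)\<^sup>2 / (2 * ennreal_of_enat (interp_capacity l F P))"
        using enat by (simp add: ennreal_mult ennreal_of_nat_eq_real_of_nat ennreal_power)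
      finally show ?thesis .
    qed
  next
    case infinity
    have "?p \<le> \<alpha>"
    proof (rule LIMSEQ_le_const)
      (* Interpolation at arbitrarily large sample sizes makes the collision term vanish. *)
      show "(\<lambda>m. \<alpha> + (real n)\<^sup>2 / (2 * real m)) \<longlonglongrightarrow> \<alpha>"
        by real_asymp
      show "\<exists>N. \<forall>m\<ge>N. ?p \<le> \<alpha> + (real n)\<^sup>2 / (2 * real m)"
        using bound infinity by (intro exI[of _ 1]) auto
    qed
    then show ?thesis
      by (simp add: infinity ennreal_mult_top ennreal_leI)
  qed
qed

end
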